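(* Suppose that no anticipation holds: $Y_{it}(g)=Y_{it}(\infty)$ for all $g\in\{2,\dots,T,\infty\}$ and $t<g$. Suppose that $\nu_i$ is independent of $(\alpha_i,\varepsilon_{i1},\dots,\varepsilon_{iT},\mu_i,\eta_{i1},\dots,\eta_{iT})$ and that there exists a partition of the support of $\nu_i$ into non-overlapping (measurable) sets $\{B_g\}_{g\in\{2,\dots,T,\infty\}}$ with $P(\nu_i\in B_g)\in(0,1)$ for every $g\in\{2,\dots,T,\infty\}$. Suppose further that for each $t\in\{2,\dots,T\}$ either $P(E[\dot Y_{it}(\infty)-\dot Y_{i(t-1)}(\infty)\mid\omega_i]>0)<1$ or $P(E[\dot Y_{it}(\infty)-\dot Y_{i(t-1)}(\infty)\mid\omega_i]<0)<1$. Then the following are equivalent: (1) for every selection mechanism $h\in\mathcal{G}_\omega$ such that $G_i=h(\omega_i,\nu_i)$ satisfies $P(G_i=g)\in(0,1)$ for all $g\in\{2,\dots,T,\infty\}$, multi-period parallel trends holds, i.e. for all $(g,t)\in\{2,\dots,T\}^2$, $$E[Y_{it}(\infty)-Y_{i(t-1)}(\infty)\mid G_i=g]=E[Y_{it}(\infty)-Y_{i(t-1)}(\infty)\mid G_i=\infty];$$ (2) $E[\dot Y_{it}(\infty)-\dot Y_{i(t-1)}(\infty)\mid\omega_i]=0$ almost surely for all $t\in\{2,\dots,T\}$.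
   Context: Staggered-adoption setting with periods $t\in\{1,\dots,T\}$, $T\ge 2$; treatment is absorbing and nobody is treated at $t=1$. For a generic unit $i$, $G_i\in\{2,\dots,T,\infty\}$ is the first treated period ($\infty$ is a label for never treated). $Y_{it}(g)$ is the period-$t$ potential outcome if first treated in period $g$, and $Y_{it}(\infty)$ the never-treated potential outcome, given by $Y_{it}(\infty)=\xi_t(\alpha_i,\varepsilon_{it})$ for arbitrary (measurable) real-valued functions $\xi_t$; $\alpha_i,\varepsilon_{i1},\dots,\varepsilon_{iT}$ are finite-dimensional random vectors, $\mu_i,\eta_{i1},\dots,\eta_{iT}$ are additional random vectors, $\nu_i$ is a scalar random variable. All relevant moments exist (in particular $E|Y_{it}(\infty)|<\infty$). $\dot Y_{it}(\infty)=Y_{it}(\infty)-E[Y_{it}(\infty)]$. $\omega_i$ is a given (measurable) function or subvector of $(\alpha_i,\varepsilon_{i1},\dots,\varepsilon_{iT},\mu_i,\eta_{i1},\dots,\eta_{iT})$. With $\mathcal{O},\mathcal{V}$ the supports of $\omega_i,\nu_i$, $\mathcal{G}_\omega$ is the class of all (measurable) functions $h:\mathcal{O}\times\mathcal{V}\to\{2,\dots,T,\infty\}$. The distribution of the unobservables is held fixed as $h$ varies. *)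

theory Defs
  imports "HOL-Probability.Probability" "HOL-Library.Extended_Nat"
begin

(* The value \<infinity> is the label of the never-treated group. *)
definition adoption_labels :: "nat \<Rightarrow> enat set" where
  "adoption_labels T = insert \<infinity> (enat ` {2..T})"

(* The topological support of the distribution of X. *)
definition rv_support :: "'w measure \<Rightarrow> ('w \<Rightarrow> 'b::topological_space) \<Rightarrow> 'b set" where
  "rv_support M X =
     {x. \<forall>U. open U \<and> x \<in> U \<longrightarrow> 0 < measure M {z \<in> space M. X z \<in> U}}"

definition unobs_space ::
  "nat \<Rightarrow> ('a::euclidean_space \<times> (nat \<Rightarrow> 'e::euclidean_space) \<times>
            'm::euclidean_space \<times> (nat \<Rightarrow> 'n::euclidean_space)) measure" where
  "unobs_space T =
     borel \<Otimes>\<^sub>M (PiM {1..T} (\<lambda>_. borel) \<Otimes>\<^sub>M (borel \<Otimes>\<^sub>M PiM {1..T} (\<lambda>_. borel)))"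

(* The restriction to {1..T} makes the time-indexed components extensional, as PiM requires. *)
definition unobs ::
  "nat \<Rightarrow> ('w \<Rightarrow> 'a) \<Rightarrow> (nat \<Rightarrow> 'w \<Rightarrow> 'e) \<Rightarrow> ('w \<Rightarrow> 'm) \<Rightarrow> (nat \<Rightarrow> 'w \<Rightarrow> 'n) \<Rightarrow>
   'w \<Rightarrow> 'a \<times> (nat \<Rightarrow> 'e) \<times> 'm \<times> (nat \<Rightarrow> 'n)" where
  "unobs T \<alpha> \<epsilon> \<mu> \<eta> x =
     (\<alpha> x, (\<lambda>t\<in>{1..T}. \<epsilon> t x), \<mu> x, (\<lambda>t\<in>{1..T}. \<eta> t x))"

(* Independence of the generated sigma-algebras; the library's indep_var
   requires both variables to have the same value type. *)
definition indep_rvs ::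
  "'w measure \<Rightarrow> 'b measure \<Rightarrow> ('w \<Rightarrow> 'b) \<Rightarrow> 'c measure \<Rightarrow> ('w \<Rightarrow> 'c) \<Rightarrow> bool" where
  "indep_rvs M N X K Z \<longleftrightarrow>
     X \<in> measurable M N \<and> Z \<in> measurable M K \<and>
     prob_space.indep_set M (sets (vimage_algebra (space M) X N))
                            (sets (vimage_algebra (space M) Z K))"

definition demeaned :: "'w measure \<Rightarrow> ('w \<Rightarrow> real) \<Rightarrow> 'w \<Rightarrow> real" where
  "demeaned M X x = X x - (\<integral>z. X z \<partial>M)"

definition cond_exp_on :: "'w measure \<Rightarrow> ('w \<Rightarrow> 'b::topological_space) \<Rightarrow> ('w \<Rightarrow> real) \<Rightarrow> 'w \<Rightarrow> real" where
  "cond_exp_on M Z X = real_cond_exp M (vimage_algebra (space M) Z borel) X"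

definition event_mean :: "'w measure \<Rightarrow> 'w set \<Rightarrow> ('w \<Rightarrow> real) \<Rightarrow> real" where
  "event_mean M A X = set_lebesgue_integral M A X / measure M A"

definition no_anticipation ::
  "'w measure \<Rightarrow> nat \<Rightarrow> (enat \<Rightarrow> nat \<Rightarrow> 'w \<Rightarrow> real) \<Rightarrow> bool" where
  "no_anticipation M T Y \<longleftrightarrow>
     (\<forall>g\<in>adoption_labels T. \<forall>t\<in>{1..T}. enat t < g \<longrightarrow> (AE x in M. Y g t x = Y \<infinity> t x))"

(* Values of h off Os \<times> Vs are unconstrained.  For the supports of the two
   arguments that set has full measure, so h determines the group variable up to
   null sets; hence the group is taken as any random variable that equals
   h of the two arguments almost surely. *)
definition selection_mechanisms ::
  "nat \<Rightarrow> 'o::topological_space set \<Rightarrow> real set \<Rightarrow> ('o \<times> real \<Rightarrow> enat) set" where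
  "selection_mechanisms T Os Vs =
     measurable (restrict_space borel (Os \<times> Vs)) (count_space (adoption_labels T))"

definition all_groups_nondegenerate :: "'w measure \<Rightarrow> nat \<Rightarrow> ('w \<Rightarrow> enat) \<Rightarrow> bool" where
  "all_groups_nondegenerate M T G \<longleftrightarrow>
     (\<forall>g\<in>adoption_labels T. 0 < measure M {x \<in> space M. G x = g} \<and>
                             measure M {x \<in> space M. G x = g} < 1)"

definition parallel_trends ::
  "'w measure \<Rightarrow> nat \<Rightarrow> (nat \<Rightarrow> 'w \<Rightarrow> real) \<Rightarrow> ('w \<Rightarrow> enat) \<Rightarrow> bool" where
  "parallel_trends M T Y0 G \<longleftrightarrow>
     (\<forall>g\<in>{2..T}. \<forall>t\<in>{2..T}.
        event_mean M {x \<in> space M. G x = enat g} (\<lambda>x. Y0 t x - Y0 (t - 1) x) =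
        event_mean M {x \<in> space M. G x = \<infinity>} (\<lambda>x. Y0 t x - Y0 (t - 1) x))"

end

(* Let D be the demeaned increment of the untreated outcome between periods t-1 and t. Group
   means that agree must equal the overall mean, so parallel trends says that D integrates to 0
   over every group, while (2) says that D integrates to 0 over {\<omega> \<in> S} for every
   Borel set S.
   Independence gives \<integral> D 1{\<omega> \<in> S, \<nu> \<in> B} = \<integral> D 1{\<omega> \<in> S} * P(\<nu> \<in> B). Under (2) this vanishes on all
   rectangles, hence by Dynkin's lemma on every event determined by (\<omega>, \<nu>), in particular on every
   group. Conversely, given S with P(\<omega> \<in> S) > 0, the mechanism that assigns label 2 exactly on
   {\<omega> \<in> S, \<nu> \<in> B_2} is admissible, and parallel trends for it forces D to integrate to 0 over
   {\<omega> \<in> S}. *)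

theory Submission
  imports Defs
begin

lemma finite_adoption_labels [simp]: "finite (adoption_labels T)"
  by (simp add: adoption_labels_def)

section \<open>Supports of random variables\<close>

lemma closed_rv_support: "closed (rv_support M X)"
proof -
  have "- rv_support M X = \<Union>{U. open U \<and> measure M {z \<in> space M. X z \<in> U} = 0}"
    by (auto simp: rv_support_def zero_less_measure_iff)
  then show ?thesis
    unfolding closed_def by (auto intro: open_Union)
qed

text \<open>Every point off the support has an open neighbourhood of probability 0. With a countable
  basis, countably many null basic sets cover all such points, so together they form a null
  event.\<close>

lemma (in prob_space) AE_in_rv_support:
  fixes X :: "'a \<Rightarrow> 'b::second_countable_topology"
  assumes [measurable]: "X \<in> borel_measurable M"
  shows "AE x in M. X x \<in> rv_support M X"
proof -
  obtain \<B> :: "'b set set" where \<B>: "countable \<B>" "topological_basis \<B>"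
    using ex_countable_basis by blast
  define \<N> where "\<N> = {b \<in> \<B>. prob {z \<in> space M. X z \<in> b} = 0}"
  have "AE x in M. X x \<notin> b" if "b \<in> \<N>" for b
  proof -
    have [measurable]: "b \<in> sets borel"
      using that topological_basis_open[OF \<B>(2)] by (auto simp: \<N>_def)
    show ?thesis
      using that by (intro AE_I[where N = "{z \<in> space M. X z \<in> b}"])
        (auto simp: \<N>_def emeasure_eq_measure)
  qed
  moreover have "countable \<N>"
    using \<B>(1) by (simp add: \<N>_def)
  ultimately have "AE x in M. \<forall>b\<in>\<N>. X x \<notin> b"
    by (simp add: AE_ball_countable)
  then show ?thesis
  proof (rule AE_mp, intro AE_I2 impI)
    fix x assume *: "\<forall>b\<in>\<N>. X x \<notin> b"
    show "X x \<in> rv_support M X"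
      unfolding rv_support_def
    proof (intro CollectI allI impI)
      fix U assume U: "open U \<and> X x \<in> U"
      then obtain b where b: "b \<in> \<B>" "X x \<in> b" "b \<subseteq> U"
        using topological_basisE[OF \<B>(2)] by metis
      have "prob {z \<in> space M. X z \<in> b} > 0"
        using * b unfolding \<N>_def by (auto simp: zero_less_measure_iff)
      also have "prob {z \<in> space M. X z \<in> b} \<le> prob {z \<in> space M. X z \<in> U}"
        using b U by (intro finite_measure_mono) (auto intro!: measurable_sets_Collect[OF assms])
      finally show "0 < prob {z \<in> space M. X z \<in> U}" .
    qed
  qed
qed

section \<open>Independence, and events over which an integral vanishes\<close>

text \<open>Leads from \<open>indep_rvs\<close> to \<open>indep_var\<close> once both variables are
  mapped into one value type. The sigma-algebra generated by \<open>f (X x)\<close> lies inside the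
  one generated by \<open>X\<close>, and independence passes to smaller families.\<close>

lemma (in prob_space) indep_rvs_comp:
  assumes "indep_rvs M N X K Z" "f \<in> measurable N N'" "g \<in> measurable K K'"
  shows "indep_var N' (\<lambda>x. f (X x)) K' (\<lambda>x. g (Z x))"
proof -
  have [measurable]: "X \<in> measurable M N" "Z \<in> measurable M K"
    and ind: "indep_set (sets (vimage_algebra (space M) X N)) (sets (vimage_algebra (space M) Z K))"
    using assms(1) by (auto simp: indep_rvs_def)
  have sub: "sigma_sets (space M) {(\<lambda>x. f (X x)) -` A \<inter> space M |A. A \<in> sets N'}
      \<subseteq> sets (vimage_algebra (space M) X N)"
    if "f \<in> measurable N N'" "X \<in> measurable M N" for f X and N :: "'x measure" and N' :: "'y measure"
  proof -
    have "(\<lambda>x. f (X x)) \<in> measurable (vimage_algebra (space M) X N) N'"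
      using measurable_compose[OF measurable_vimage_algebra1 that(1)] that(2)
      by (auto simp: measurable_def)
    then have "{(\<lambda>x. f (X x)) -` A \<inter> space M |A. A \<in> sets N'} \<subseteq> sets (vimage_algebra (space M) X N)"
      by (auto simp: measurable_def)
    then show ?thesis
      using sets.sigma_sets_subset[of _ "vimage_algebra (space M) X N"] by simp
  qed
  note [measurable] = assms(2,3)
  have "indep_set (sigma_sets (space M) {(\<lambda>x. f (X x)) -` A \<inter> space M |A. A \<in> sets N'})
      (sigma_sets (space M) {(\<lambda>x. g (Z x)) -` A \<inter> space M |A. A \<in> sets K'})"
    using ind unfolding indep_set_def
  proof (rule indep_sets_mono_sets)
    fix i
    show "case_bool (sigma_sets (space M) {(\<lambda>x. f (X x)) -` A \<inter> space M |A. A \<in> sets N'})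
          (sigma_sets (space M) {(\<lambda>x. g (Z x)) -` A \<inter> space M |A. A \<in> sets K'}) i
        \<subseteq> case_bool (sets (vimage_algebra (space M) X N)) (sets (vimage_algebra (space M) Z K)) i"
      using sub[OF assms(2)] sub[OF assms(3)] by (cases i) simp_all
  qed
  then show ?thesis
    by (simp add: indep_var_eq)
qed

text \<open>Dynkin's lemma for the class of sets \<open>S\<close> over which the integral vanishes:
  rectangles generate the product sigma-algebra and are stable under intersection, and additivity of
  the integral handles complements and countable disjoint unions.\<close>

lemma (in prob_space) integral_zero_on_rectangles:
  fixes D :: "'a \<Rightarrow> real"
  assumes D: "integrable M D"
    and [measurable]: "X \<in> measurable M N" "Z \<in> measurable M K"
    and rect: "\<And>A B. A \<in> sets N \<Longrightarrow> B \<in> sets K \<Longrightarrow>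
      (LINT x:{x \<in> space M. X x \<in> A \<and> Z x \<in> B}|M. D x) = 0"
    and S: "S \<in> sets (N \<Otimes>\<^sub>M K)"
  shows "(LINT x:{x \<in> space M. (X x, Z x) \<in> S}|M. D x) = 0"
proof -
  let ?E = "{a \<times> b |a b. a \<in> sets N \<and> b \<in> sets K}"
  let ?I = "\<lambda>S. {x \<in> space M. (X x, Z x) \<in> S}"
  have int: "set_integrable M A D" if "A \<in> sets M" for A
    unfolding set_integrable_def using that D by (rule integrable_mult_indicator)
  have Sp: "(X x, Z x) \<in> space N \<times> space K" if "x \<in> space M" for x
    using that assms(2,3) by (auto simp: measurable_def)
  have sig: "sigma_sets (space N \<times> space K) ?E = sets (N \<Otimes>\<^sub>M K)"
    by (simp add: sets_pair_measure)
  have meas: "?I S \<in> sets M" if "S \<in> sets (N \<Otimes>\<^sub>M K)" for S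
    using that by measurable
  have "Int_stable ?E" "?E \<subseteq> Pow (space N \<times> space K)"
    by (rule Int_stable_pair_measure_generator pair_measure_closed)+
  moreover have "S \<in> sigma_sets (space N \<times> space K) ?E"
    using S sig by simp
  ultimately show ?thesis
  proof (induction rule: sigma_sets_induct_disjoint)
    case (basic A)
    then show ?case using rect by force
  next
    case empty
    show ?case by (simp add: set_lebesgue_integral_def)
  next
    case (compl A)
    have "A \<in> sets (N \<Otimes>\<^sub>M K)" using compl sig by simp
    note A = meas[OF this]
    \<comment> \<open>The whole space is the event of the rectangle
      \<open>space N \<times> space K\<close>, so the complement follows by subtraction.\<close>
    have all: "(LINT x:space M|M. D x) = 0"
      using rect[of "space N" "space K"] Sp by (auto cong: conj_cong)
    have "(LINT x:?I (space N \<times> space K - A) \<union> ?I A|M. D x)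
        = (LINT x:?I (space N \<times> space K - A)|M. D x) + (LINT x:?I A|M. D x)"
      using compl sig by (intro set_integral_Un int meas) (auto simp flip: space_pair_measure)
    moreover have "?I (space N \<times> space K - A) \<union> ?I A = space M"
      using Sp by auto
    ultimately show ?case using all compl by simp
  next
    case (union A)
    have A: "A i \<in> sets (N \<Otimes>\<^sub>M K)" for i using union sig by auto
    have "(LINT x:(\<Union>i. ?I (A i))|M. D x) = (\<Sum>i. LINT x:?I (A i)|M. D x)"
      using union(1) A
      by (intro lebesgue_integral_countable_add int meas sets.countable_UN)
         (auto simp: disjoint_family_on_def)
    moreover have "?I (\<Union>i. A i) = (\<Union>i. ?I (A i))" by auto
    ultimately show ?case using union by simp
  qed
qed

text \<open>The sigma-algebra generated by \<open>Z\<close> consists exactly of the preimages of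
  Borel sets under \<open>Z\<close>, so this is the characterisation of conditional expectation by
  integrals, with 0 as the candidate version.\<close>

lemma (in prob_space) cond_exp_on_eq_0_iff:
  assumes [measurable]: "Z \<in> borel_measurable M" and D: "integrable M D"
  shows "(AE x in M. cond_exp_on M Z D x = 0) \<longleftrightarrow>
    (\<forall>S\<in>sets borel. (LINT x:{x \<in> space M. Z x \<in> S}|M. D x) = 0)"
proof -
  let ?F = "vimage_algebra (space M) Z borel"
  have "subalgebra M ?F"
    by (auto simp: subalgebra_def sets_vimage_algebra2)
  then interpret F: finite_measure_subalgebra M ?F
    by unfold_locales
  have eq: "Z -` S \<inter> space M = {x \<in> space M. Z x \<in> S}" for S by auto
  show ?thesis
  proof
    assume 0: "AE x in M. cond_exp_on M Z D x = 0"
    show "\<forall>S\<in>sets borel. (LINT x:{x \<in> space M. Z x \<in> S}|M. D x) = 0"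
    proof
      fix S :: "'b set" assume S: "S \<in> sets borel"
      have "(LINT x:{x \<in> space M. Z x \<in> S}|M. D x)
          = (LINT x:{x \<in> space M. Z x \<in> S}|M. cond_exp_on M Z D x)"
        unfolding cond_exp_on_def using S D
        by (intro F.real_cond_exp_intA) (auto simp: sets_vimage_algebra2 simp flip: eq)
      also have "\<dots> = 0"
        unfolding set_lebesgue_integral_def using 0 by (intro integral_eq_zero_AE) auto
      finally show "(LINT x:{x \<in> space M. Z x \<in> S}|M. D x) = 0" .
    qed
  next
    assume "\<forall>S\<in>sets borel. (LINT x:{x \<in> space M. Z x \<in> S}|M. D x) = 0"
    then show "AE x in M. cond_exp_on M Z D x = 0"
      unfolding cond_exp_on_def using D
      by (intro F.real_cond_exp_charact)
         (auto simp: sets_vimage_algebra2 eq set_lebesgue_integral_def)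
  qed
qed

section \<open>Group means and group events\<close>

text \<open>The groups partition the sample space, so the overall mean of an increment is the
  average of the group means weighted by the group probabilities. Group means that all agree
  therefore equal it, and subtracting it makes every group integral 0.\<close>

lemma (in prob_space) parallel_trends_iff:
  assumes [measurable]: "G \<in> measurable M (count_space (adoption_labels T))"
    and nondeg: "all_groups_nondegenerate M T G"
    and X: "\<And>t. t \<in> {1..T} \<Longrightarrow> integrable M (X t)"
  shows "parallel_trends M T X G \<longleftrightarrow>
    (\<forall>t\<in>{2..T}. \<forall>g\<in>adoption_labels T.
      (LINT x:{x \<in> space M. G x = g}|M. demeaned M (X t) x - demeaned M (X (t - 1)) x) = 0)"
proof -
  let ?A = "\<lambda>g. {x \<in> space M. G x = g}"
  have A: "?A g \<in> sets M" for g
  proof (cases "g \<in> adoption_labels T")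
    case True then show ?thesis by measurable
  next
    case False
    then have "?A g = {}" using assms(1) by (auto simp: measurable_def)
    then show ?thesis by simp
  qed
  have "(\<forall>g\<in>{2..T}. event_mean M (?A (enat g)) (\<lambda>x. X t x - X (t - 1) x)
          = event_mean M (?A \<infinity>) (\<lambda>x. X t x - X (t - 1) x))
      \<longleftrightarrow> (\<forall>g\<in>adoption_labels T.
          (LINT x:?A g|M. demeaned M (X t) x - demeaned M (X (t - 1)) x) = 0)"
    (is "?L \<longleftrightarrow> ?R") if t: "t \<in> {2..T}" for t
  proof -
    let ?X = "\<lambda>x. X t x - X (t - 1) x"
    let ?m = "expectation ?X"
    have iX: "integrable M (X t)" "integrable M (X (t - 1))"
      using t by (auto intro!: X)
    then have i: "integrable M ?X" by simp
    have si: "set_integrable M A ?X" if "A \<in> sets M" for A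
      unfolding set_integrable_def by (rule integrable_mult_indicator[OF that i])
    \<comment> \<open>Demeaning both outcomes shifts the increment by one constant, the mean of the
      increment.\<close>
    have dem: "demeaned M (X t) x - demeaned M (X (t - 1)) x = ?X x - ?m" for x
      using iX by (simp add: demeaned_def)
    have "(LINT x:?A g|M. ?X x - ?m) = (LINT x:?A g|M. ?X x) - ?m * prob (?A g)" for g
    proof -
      have "set_integrable M (?A g) (\<lambda>_. ?m)"
        unfolding set_integrable_def by (rule integrable_mult_indicator[OF A]) simp
      then have "(LINT x:?A g|M. ?X x - ?m) = (LINT x:?A g|M. ?X x) - (LINT x:?A g|M. ?m)"
        by (rule set_integral_diff(2)[OF si[OF A]])
      also have "(LINT x:?A g|M. ?m) = ?m * prob (?A g)"
        using A by (simp add: set_integral_const)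
      finally show ?thesis .
    qed
    then have dem_int: "(LINT x:?A g|M. demeaned M (X t) x - demeaned M (X (t - 1)) x)
        = (LINT x:?A g|M. ?X x) - ?m * prob (?A g)" for g
      unfolding dem .
    \<comment> \<open>On a null group \<open>event_mean\<close> would be a division by 0, hence 0
      whatever the overall mean is; positivity makes the conversion to integrals an
      equivalence.\<close>
    have pos: "prob (?A g) > 0" if "g \<in> adoption_labels T" for g
      using nondeg that by (simp add: all_groups_nondegenerate_def)
    have R: "?R \<longleftrightarrow> (\<forall>g\<in>adoption_labels T. event_mean M (?A g) ?X = ?m)"
    proof (intro ball_cong refl)
      fix g assume "g \<in> adoption_labels T"
      then show "(LINT x:?A g|M. demeaned M (X t) x - demeaned M (X (t - 1)) x) = 0
          \<longleftrightarrow> event_mean M (?A g) ?X = ?m"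
        using pos[of g] unfolding dem_int event_mean_def by (subst divide_eq_eq) auto
    qed
    show ?thesis
    proof
      assume L: ?L
      \<comment> \<open>The never-treated mean is the common right-hand side in
        \<open>parallel_trends\<close>; summing over the partition identifies it with the overall
        mean.\<close>
      define c where "c = event_mean M (?A \<infinity>) ?X"
      have c: "(LINT x:?A g|M. ?X x) = c * prob (?A g)" if "g \<in> adoption_labels T" for g
        using L that pos[OF that] unfolding c_def
        by (auto simp: adoption_labels_def event_mean_def field_simps)
      have cover: "(\<Union>g\<in>adoption_labels T. ?A g) = space M"
        using assms(1) by (auto simp: measurable_def)
      have disj: "disjoint_family_on ?A (adoption_labels T)"
        by (auto simp: disjoint_family_on_def)
      have "?m = (LINT x:(\<Union>g\<in>adoption_labels T. ?A g)|M. ?X x)"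
        using i by (simp add: cover set_integral_space)
      also have "\<dots> = (\<Sum>g\<in>adoption_labels T. LINT x:?A g|M. ?X x)"
        using disj by (intro set_integral_finite_Union si A) auto
      also have "\<dots> = c * (\<Sum>g\<in>adoption_labels T. prob (?A g))"
        unfolding sum_distrib_left by (intro sum.cong refl c)
      also have "(\<Sum>g\<in>adoption_labels T. prob (?A g)) = prob (\<Union>g\<in>adoption_labels T. ?A g)"
        using A disj by (intro finite_measure_finite_Union[symmetric]) auto
      also have "\<dots> = 1" by (simp add: cover prob_space)
      finally have "c = ?m" by simp
      then show ?R
        unfolding R using L by (auto simp: c_def adoption_labels_def)
    next
      assume ?R
      then show ?L unfolding R by (simp add: adoption_labels_def)
    qed
  qed
  then show ?thesis unfolding parallel_trends_def by blast
qed

text \<open>\<open>h\<close> is measurable only relative to the product of the two supports, so its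
  level set is cut down to that product, which is closed and hence Borel. The pair of arguments lies
  there almost surely, so the group differs only by a null set from an event determined by \<omega>
  and \<nu>, to which the rectangle criterion applies.\<close>

lemma (in prob_space) AE_group_eq_imp_integral_zero:
  fixes \<omega> :: "'a \<Rightarrow> 'o::euclidean_space" and \<nu> D :: "'a \<Rightarrow> real"
  assumes [measurable]: "\<omega> \<in> borel_measurable M" "\<nu> \<in> borel_measurable M"
    and D: "integrable M D"
    and rect: "\<And>A B. A \<in> sets borel \<Longrightarrow> B \<in> sets borel \<Longrightarrow>
      (LINT x:{x \<in> space M. \<omega> x \<in> A \<and> \<nu> x \<in> B}|M. D x) = 0"
    and h: "h \<in> selection_mechanisms T (rv_support M \<omega>) (rv_support M \<nu>)"
    and [measurable]: "G \<in> measurable M (count_space (adoption_labels T))"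
    and Gh: "AE x in M. G x = h (\<omega> x, \<nu> x)"
    and g: "g \<in> adoption_labels T"
  shows "(LINT x:{x \<in> space M. G x = g}|M. D x) = 0"
proof -
  let ?R = "rv_support M \<omega> \<times> rv_support M \<nu>"
  let ?S = "h -` {g} \<inter> ?R"
  have R: "?R \<in> sets borel"
    by (intro borel_closed closed_Times closed_rv_support)
  have "h -` {g} \<inter> space (restrict_space borel ?R) \<in> sets (restrict_space borel ?R)"
    using h g unfolding selection_mechanisms_def by (intro measurable_sets) auto
  then have "?S \<in> sets borel"
    using R by (simp add: space_restrict_space sets_restrict_space_iff)
  \<comment> \<open>Passes from the Borel sets of the product space to the product sigma-algebra, on
    which the rectangle criterion is stated.\<close>
  then have S: "?S \<in> sets (borel \<Otimes>\<^sub>M borel)"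
    unfolding borel_prod .
  have "{x \<in> space M. (\<omega> x, \<nu> x) \<in> ?S} \<in> sets M"
    using S by measurable
  moreover have "{x \<in> space M. G x = g} \<in> sets M"
    using g by measurable
  moreover have "AE x in M. x \<in> {x \<in> space M. G x = g} \<longleftrightarrow> x \<in> {x \<in> space M. (\<omega> x, \<nu> x) \<in> ?S}"
    using Gh AE_in_rv_support[OF assms(1)] AE_in_rv_support[OF assms(2)]
    by eventually_elim auto
  ultimately have "(LINT x:{x \<in> space M. G x = g}|M. D x)
      = (LINT x:{x \<in> space M. (\<omega> x, \<nu> x) \<in> ?S}|M. D x)"
    using D by (intro set_integral_cong_set) (auto simp: set_borel_measurable_def)
  also have "\<dots> = 0"
    by (rule integral_zero_on_rectangles[OF D assms(1,2) rect S])
  finally show ?thesis .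
qed

section \<open>Factorisation under independence\<close>

text \<open>The indicator of the joint event splits, so the integrand is a function of
  \<open>Z\<close> times a function of \<open>U\<close>, and the expectation of such a product
  factors. \<open>d (U x)\<close> and \<open>w (U x)\<close> may depend on each other; both are
  absorbed into the factor \<open>?f\<close>.\<close>

lemma (in prob_space) indep_rvs_set_integral:
  fixes d :: "'u \<Rightarrow> real"
  assumes ind: "indep_rvs M K Z N U"
    and w: "w \<in> measurable N L" and d: "d \<in> borel_measurable N" "integrable M (\<lambda>x. d (U x))"
    and S: "S \<in> sets L" and B: "B \<in> sets K"
  shows "(LINT x:{x \<in> space M. w (U x) \<in> S \<and> Z x \<in> B}|M. d (U x)) =
    (LINT x:{x \<in> space M. w (U x) \<in> S}|M. d (U x)) * prob {x \<in> space M. Z x \<in> B}"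
proof -
  have [measurable]: "Z \<in> measurable M K" "U \<in> measurable M N"
    using ind by (auto simp: indep_rvs_def)
  note [measurable] = w d(1) S B
  let ?f = "\<lambda>u. indicator S (w u) * d u"
  have "indep_var borel (\<lambda>x. indicator B (Z x) :: real) borel (\<lambda>x. ?f (U x))"
    by (rule indep_rvs_comp[OF ind, where f = "indicator B" and g = ?f]) measurable
  moreover have "integrable M (\<lambda>x. indicator B (Z x) :: real)"
    by (intro integrable_const_bound[where B = 1]) (auto simp: indicator_def)
  moreover have "integrable M (\<lambda>x. ?f (U x))"
    by (rule Bochner_Integration.integrable_bound[OF d(2)]) (auto simp: indicator_def)
  ultimately have "expectation (\<lambda>x. indicator B (Z x) * ?f (U x)) =
      expectation (\<lambda>x. indicator B (Z x)) * expectation (\<lambda>x. ?f (U x))"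
    by (intro indep_var_lebesgue_integral)
  moreover have "expectation (\<lambda>x. indicator B (Z x)) = prob {x \<in> space M. Z x \<in> B}"
  proof -
    have "expectation (\<lambda>x. indicator B (Z x)) = expectation (indicator {x \<in> space M. Z x \<in> B} :: 'a \<Rightarrow> real)"
      by (intro Bochner_Integration.integral_cong) (auto simp: indicator_def)
    then show ?thesis by simp
  qed
  moreover have "(LINT x:{x \<in> space M. w (U x) \<in> S \<and> Z x \<in> B}|M. d (U x)) =
      expectation (\<lambda>x. indicator B (Z x) * ?f (U x))"
    unfolding set_lebesgue_integral_def
    by (intro Bochner_Integration.integral_cong) (auto simp: indicator_def)
  moreover have "(LINT x:{x \<in> space M. w (U x) \<in> S}|M. d (U x)) = expectation (\<lambda>x. ?f (U x))"
    unfolding set_lebesgue_integral_def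
    by (intro Bochner_Integration.integral_cong) (auto simp: indicator_def)
  ultimately show ?thesis by (simp add: mult.commute)
qed

section \<open>Construction of an admissible mechanism\<close>

text \<open>In the application the cells cover only the support of \<nu>, so a total labelling needs
  a default. Points in no cell get \<infinity>, which is why the last property is restricted to
  finite labels.\<close>

lemma exists_partition_label:
  assumes B: "\<And>g. g \<in> adoption_labels T \<Longrightarrow> B g \<in> sets N"
    and disj: "disjoint_family_on B (adoption_labels T)"
  obtains q where "q \<in> measurable N (count_space (adoption_labels T))"
    and "\<And>g v. g \<in> adoption_labels T \<Longrightarrow> v \<in> B g \<Longrightarrow> q v = g"
    and "\<And>g v. g \<noteq> \<infinity> \<Longrightarrow> q v = g \<Longrightarrow> v \<in> B g"
proof -
  define q where "q v = (if \<exists>g\<in>adoption_labels T. v \<in> B g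
    then THE g. g \<in> adoption_labels T \<and> v \<in> B g else \<infinity>)" for v
  have q1: "q v = g" if "g \<in> adoption_labels T" "v \<in> B g" for g v
  proof -
    have "(THE g. g \<in> adoption_labels T \<and> v \<in> B g) = g"
      using that disj by (intro the_equality) (auto simp: disjoint_family_on_def)
    then show ?thesis using that by (auto simp: q_def)
  qed
  have q_lab: "q v \<in> adoption_labels T" for v
    using q1[of _ v] by (cases "\<exists>g\<in>adoption_labels T. v \<in> B g")
      (auto simp: q_def adoption_labels_def)
  have q2: "v \<in> B g" if "g \<noteq> \<infinity>" "q v = g" for g v
    using that q1[of _ v] by (cases "\<exists>g\<in>adoption_labels T. v \<in> B g") (auto simp: q_def)
  have fin: "q -` {g} \<inter> space N \<in> sets N" if "g \<in> adoption_labels T" "g \<noteq> \<infinity>" for g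
  proof -
    have "q -` {g} \<inter> space N = B g"
      using q1 q2 that sets.sets_into_space[OF B[OF that(1)]] by blast
    then show ?thesis using B that by simp
  qed
  have "q \<in> measurable N (count_space (adoption_labels T))"
  proof (subst measurable_count_space_eq2, simp, intro conjI ballI)
    fix g assume g: "g \<in> adoption_labels T"
    show "q -` {g} \<inter> space N \<in> sets N"
    proof (cases "g = \<infinity>")
      case True
      \<comment> \<open>The preimage of \<infinity> holds the default points besides its cell, so it
        is obtained as the complement of the finitely many other preimages.\<close>
      then have "q -` {g} \<inter> space N
          = space N - (\<Union>g\<in>adoption_labels T - {\<infinity>}. q -` {g} \<inter> space N)"
        using q_lab by auto
      also have "\<dots> \<in> sets N"
        using fin by (intro sets.Diff sets.finite_UN) auto
      finally show ?thesis .
    qed (use fin g in auto)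
  qed (use q_lab in auto)
  then show ?thesis using q1 q2 that by blast
qed

text \<open>Starting from the assignment by the cells of the partition, only the units with
  \<open>\<omega>\<close> in \<open>S\<close> are kept in group 2 and the others move to the never treated. All other treated
  groups are still chosen by \<open>\<nu>\<close> alone.\<close>
lemma (in prob_space) exists_selection_mechanism:
  fixes \<omega> :: "'a \<Rightarrow> 'o::euclidean_space" and \<nu> :: "'a \<Rightarrow> real"
  assumes T: "T \<ge> 2"
    and [measurable]: "\<omega> \<in> borel_measurable M" "\<nu> \<in> borel_measurable M" "S \<in> sets borel"
    and B: "\<And>g. g \<in> adoption_labels T \<Longrightarrow> B g \<in> sets borel"
    and disj: "disjoint_family_on B (adoption_labels T)"
    and pos: "\<And>g. g \<in> adoption_labels T \<Longrightarrow> prob {x \<in> space M. \<nu> x \<in> B g} > 0"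
    and pos2: "prob {x \<in> space M. \<omega> x \<in> S \<and> \<nu> x \<in> B (enat 2)} > 0"
  obtains h where "h \<in> selection_mechanisms T Os Vs"
    and "(\<lambda>x. h (\<omega> x, \<nu> x)) \<in> measurable M (count_space (adoption_labels T))"
    and "all_groups_nondegenerate M T (\<lambda>x. h (\<omega> x, \<nu> x))"
    and "\<And>x. h (\<omega> x, \<nu> x) = enat 2 \<longleftrightarrow> \<omega> x \<in> S \<and> \<nu> x \<in> B (enat 2)"
proof -
  obtain q where [measurable]: "q \<in> measurable borel (count_space (adoption_labels T))"
    and q1: "\<And>g v. g \<in> adoption_labels T \<Longrightarrow> v \<in> B g \<Longrightarrow> q v = g"
    and q2: "\<And>g v. g \<noteq> \<infinity> \<Longrightarrow> q v = g \<Longrightarrow> v \<in> B g"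
    using exists_partition_label[OF B disj] by blast
  have two: "enat 2 \<in> adoption_labels T" and inf: "\<infinity> \<in> adoption_labels T"
    using T by (auto simp: adoption_labels_def)
  define h :: "'o \<times> real \<Rightarrow> enat" where
    "h = (\<lambda>z. if q (snd z) = enat 2 \<and> fst z \<notin> S then \<infinity> else q (snd z))"
  have [measurable]: "h \<in> measurable (borel \<Otimes>\<^sub>M borel) (count_space (adoption_labels T))"
  proof -
    have q [measurable]: "(\<lambda>z. q (snd z))
        \<in> measurable (borel \<Otimes>\<^sub>M borel) (count_space (adoption_labels T))"
      by (rule measurable_compose[OF measurable_snd]) fact
    have "{z \<in> space (borel \<Otimes>\<^sub>M borel). q (snd z) = enat 2} \<in> sets (borel \<Otimes>\<^sub>M borel)"
      using measurable_sets[OF q, of "{enat 2}"] two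
      by (simp add: vimage_def Collect_conj_eq Int_commute)
    then have [measurable]: "Measurable.pred (borel \<Otimes>\<^sub>M borel) (\<lambda>z. q (snd z) = enat 2)"
      by (simp add: pred_def)
    show ?thesis
      unfolding h_def using inf by (intro measurable_If q) auto
  qed
  then have "h \<in> measurable borel (count_space (adoption_labels T))"
    by (simp add: borel_prod)
  \<comment> \<open>\<open>h\<close> is measurable on the whole product space, hence on any
    restricted domain \<open>Os \<times> Vs\<close>.\<close>
  then have sel: "h \<in> selection_mechanisms T Os Vs"
    unfolding selection_mechanisms_def by (rule measurable_restrict_space1)
  let ?G = "\<lambda>x. h (\<omega> x, \<nu> x)"
  have G [measurable]: "?G \<in> measurable M (count_space (adoption_labels T))"
    by measurable
  have h2: "?G x = enat 2 \<longleftrightarrow> \<omega> x \<in> S \<and> \<nu> x \<in> B (enat 2)" for x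
    using q1[OF two] q2[of "enat 2"] by (auto simp: h_def)
  have meas: "{x \<in> space M. ?G x = g} \<in> sets M" if "g \<in> adoption_labels T" for g
    using that by measurable
  have Gpos: "prob {x \<in> space M. ?G x = g} > 0" if g: "g \<in> adoption_labels T" for g
  proof (cases "g = enat 2")
    case True then show ?thesis using pos2 h2 by simp
  next
    case False
    \<comment> \<open>Every group other than 2 contains its whole cell; the never-treated group also
      receives the units moved out of group 2.\<close>
    have "prob {x \<in> space M. \<nu> x \<in> B g} \<le> prob {x \<in> space M. ?G x = g}"
      using q1[OF g] False by (intro finite_measure_mono meas g) (auto simp: h_def)
    then show ?thesis using pos[OF g] by simp
  qed
  have "prob {x \<in> space M. ?G x = g} < 1" if g: "g \<in> adoption_labels T" for g
  proof -
    \<comment> \<open>As 2 and \<infinity> are both labels, a second group always exists. It is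
      disjoint from the first and has positive probability, so the first cannot have probability
      1.\<close>
    obtain g' where g': "g' \<in> adoption_labels T" "g' \<noteq> g"
      using two inf by (metis enat.distinct(2))
    have "prob {x \<in> space M. ?G x = g} + prob {x \<in> space M. ?G x = g'}
        = prob ({x \<in> space M. ?G x = g} \<union> {x \<in> space M. ?G x = g'})"
      using g g' by (intro finite_measure_Union[symmetric] meas) auto
    also have "\<dots> \<le> 1" by simp
    finally show ?thesis using Gpos[OF g'(1)] by simp
  qed
  then show ?thesis
    using that[OF sel G] Gpos h2 by (simp add: all_groups_nondegenerate_def)
qed

section \<open>Equivalence of parallel trends and vanishing conditional means\<close>

theorem theoremB1:
  fixes M :: "'w measure"
    and T :: nat
    and Y :: "enat \<Rightarrow> nat \<Rightarrow> 'w \<Rightarrow> real"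
    and \<xi> :: "nat \<Rightarrow> 'a::euclidean_space \<times> 'e::euclidean_space \<Rightarrow> real"
    and \<alpha> :: "'w \<Rightarrow> 'a"
    and \<epsilon> :: "nat \<Rightarrow> 'w \<Rightarrow> 'e"
    and \<mu> :: "'w \<Rightarrow> 'm::euclidean_space"
    and \<eta> :: "nat \<Rightarrow> 'w \<Rightarrow> 'n::euclidean_space"
    and \<nu> :: "'w \<Rightarrow> real"
    and \<omega> :: "'w \<Rightarrow> 'o::euclidean_space"
    and w :: "'a \<times> (nat \<Rightarrow> 'e) \<times> 'm \<times> (nat \<Rightarrow> 'n) \<Rightarrow> 'o"
  assumes "prob_space M"
    and "T \<ge> 2"
    and "\<alpha> \<in> borel_measurable M"
    and "\<And>t. t \<in> {1..T} \<Longrightarrow> \<epsilon> t \<in> borel_measurable M"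
    and "\<mu> \<in> borel_measurable M"
    and "\<And>t. t \<in> {1..T} \<Longrightarrow> \<eta> t \<in> borel_measurable M"
    and "\<nu> \<in> borel_measurable M"
    and "\<And>t. t \<in> {1..T} \<Longrightarrow> \<xi> t \<in> borel_measurable borel"
    and "\<And>g t. g \<in> adoption_labels T \<Longrightarrow> t \<in> {1..T} \<Longrightarrow> Y g t \<in> borel_measurable M"
    and "\<And>t x. t \<in> {1..T} \<Longrightarrow> x \<in> space M \<Longrightarrow> Y \<infinity> t x = \<xi> t (\<alpha> x, \<epsilon> t x)"
    and "\<And>t. t \<in> {1..T} \<Longrightarrow> integrable M (Y \<infinity> t)"
    and "w \<in> borel_measurable (unobs_space T)"
    and "\<And>x. x \<in> space M \<Longrightarrow> \<omega> x = w (unobs T \<alpha> \<epsilon> \<mu> \<eta> x)"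
    and "no_anticipation M T Y"
    and "indep_rvs M borel \<nu> (unobs_space T) (unobs T \<alpha> \<epsilon> \<mu> \<eta>)"
    and "\<exists>B :: enat \<Rightarrow> real set.
           (\<forall>g\<in>adoption_labels T. B g \<in> sets borel) \<and>
           disjoint_family_on B (adoption_labels T) \<and>
           (\<Union>g\<in>adoption_labels T. B g) = rv_support M \<nu> \<and>
           (\<forall>g\<in>adoption_labels T. 0 < measure M {x \<in> space M. \<nu> x \<in> B g} \<and>
                                   measure M {x \<in> space M. \<nu> x \<in> B g} < 1)"
    and "\<And>t. t \<in> {2..T} \<Longrightarrow>
           measure M {x \<in> space M. cond_exp_on M \<omega>
             (\<lambda>z. demeaned M (Y \<infinity> t) z - demeaned M (Y \<infinity> (t - 1)) z) x > 0} < 1 \<or>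
           measure M {x \<in> space M. cond_exp_on M \<omega>
             (\<lambda>z. demeaned M (Y \<infinity> t) z - demeaned M (Y \<infinity> (t - 1)) z) x < 0} < 1"
  shows
    "(\<forall>h \<in> selection_mechanisms T (rv_support M \<omega>) (rv_support M \<nu>).
        \<forall>G \<in> measurable M (count_space (adoption_labels T)).
          (AE x in M. G x = h (\<omega> x, \<nu> x)) \<longrightarrow>
          all_groups_nondegenerate M T G \<longrightarrow>
          parallel_trends M T (Y \<infinity>) G)
     \<longleftrightarrow>
     (\<forall>t\<in>{2..T}. AE x in M. cond_exp_on M \<omega>
        (\<lambda>z. demeaned M (Y \<infinity> t) z - demeaned M (Y \<infinity> (t - 1)) z) x = 0)"
proof -
  interpret prob_space M by fact
  let ?U = "unobs T \<alpha> \<epsilon> \<mu> \<eta>"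
  let ?N = "unobs_space T :: ('a \<times> (nat \<Rightarrow> 'e) \<times> 'm \<times> (nat \<Rightarrow> 'n)) measure"
  note ind = assms(15) and w [measurable] = assms(12) and \<omega>w = assms(13)
    and \<nu> [measurable] = assms(7)
  have U [measurable]: "?U \<in> measurable M ?N"
    using ind by (simp add: indep_rvs_def)
  have \<omega> [measurable]: "\<omega> \<in> borel_measurable M"
    using measurable_compose[OF U w] by (subst measurable_cong[OF \<omega>w])
  define D where "D t z = demeaned M (Y \<infinity> t) z - demeaned M (Y \<infinity> (t - 1)) z" for t z
  have D: "integrable M (D t)" if "t \<in> {2..T}" for t
  proof -
    have "integrable M (Y \<infinity> t)" "integrable M (Y \<infinity> (t - 1))"
      using that by (auto intro!: assms(11))
    then show ?thesis unfolding D_def demeaned_def by auto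
  qed
  have \<omega>_set: "{x \<in> space M. \<omega> x \<in> S \<and> P x} = {x \<in> space M. w (?U x) \<in> S \<and> P x}" for S P
    using \<omega>w by auto
  have factor: "(LINT x:{x \<in> space M. \<omega> x \<in> S \<and> \<nu> x \<in> B}|M. D t x) =
      (LINT x:{x \<in> space M. \<omega> x \<in> S}|M. D t x) * prob {x \<in> space M. \<nu> x \<in> B}"
    if t: "t \<in> {2..T}" and S: "S \<in> sets borel" and B: "B \<in> sets borel" for t S B
  proof -
    \<comment> \<open>The outcome model enters here: \<open>y s\<close> reads the untreated outcome
      of period \<open>s\<close> off the vector of unobservables, so that \<open>D t\<close> becomes
      a function \<open>d\<close> of a vector independent of \<nu>.\<close>
    define y where "y s u = \<xi> s (fst u, fst (snd u) s)"
      for s and u :: "'a \<times> (nat \<Rightarrow> 'e) \<times> 'm \<times> (nat \<Rightarrow> 'n)"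
    have y: "y s \<in> borel_measurable ?N" if s: "s \<in> {1..T}" for s
    proof -
      have "(\<lambda>u. (fst u, fst (snd u) s)) \<in> measurable ?N (borel \<Otimes>\<^sub>M borel)"
        using s unfolding unobs_space_def by measurable
      then show ?thesis
        using assms(8)[OF s] unfolding y_def borel_prod by (rule measurable_compose)
    qed
    define d where "d u = (y t u - expectation (Y \<infinity> t))
      - (y (t - 1) u - expectation (Y \<infinity> (t - 1)))" for u
    \<comment> \<open>Since t \<ge> 2, both periods lie in the index range, where the restriction in
      \<open>unobs\<close> returns the original \<epsilon>.\<close>
    have ts: "t \<in> {1..T}" "t - 1 \<in> {1..T}" using t by auto
    note [measurable] = y[OF ts(1)] y[OF ts(2)]
    have d [measurable]: "d \<in> borel_measurable ?N"
      unfolding d_def by measurable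
    have Dd: "D t x = d (?U x)" if "x \<in> space M" for x
      unfolding D_def d_def demeaned_def y_def unobs_def
        assms(10)[OF ts(1) that] assms(10)[OF ts(2) that]
      using ts by simp
    have "integrable M (\<lambda>x. d (?U x))"
      using D[OF t] by (subst Bochner_Integration.integrable_cong[OF refl Dd, symmetric]) auto
    note * = indep_rvs_set_integral[OF ind w d this S B]
    have cong: "(LINT x:A|M. D t x) = (LINT x:A|M. d (?U x))" for A
      unfolding set_lebesgue_integral_def
      by (intro Bochner_Integration.integral_cong) (auto simp: Dd)
    show ?thesis
      using * \<omega>_set[of S "\<lambda>x. \<nu> x \<in> B"] \<omega>_set[of S "\<lambda>_. True"] by (simp add: cong)
  qed
  have prob_factor: "prob {x \<in> space M. \<omega> x \<in> S \<and> \<nu> x \<in> B} =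
      prob {x \<in> space M. \<omega> x \<in> S} * prob {x \<in> space M. \<nu> x \<in> B}"
    if S: "S \<in> sets borel" and B: "B \<in> sets borel" for S B
  proof -
    note [measurable] = S B
    have const: "(LINT x:A|M. 1) = prob A" if "A \<in> events" for A
      using that by (simp add: set_integral_const)
    \<comment> \<open>With the constant 1 as integrand, the factorisation of integrals becomes the
      product rule for probabilities.\<close>
    have "(LINT x:{x \<in> space M. w (?U x) \<in> S \<and> \<nu> x \<in> B}|M. 1) =
        (LINT x:{x \<in> space M. w (?U x) \<in> S}|M. 1) * prob {x \<in> space M. \<nu> x \<in> B}"
      by (rule indep_rvs_set_integral[OF ind w _ _ S B]) auto
    then have "prob {x \<in> space M. w (?U x) \<in> S \<and> \<nu> x \<in> B} =
        prob {x \<in> space M. w (?U x) \<in> S} * prob {x \<in> space M. \<nu> x \<in> B}"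
      by (subst (asm) (1 2) const) measurable
    then show ?thesis
      using \<omega>_set[of S "\<lambda>x. \<nu> x \<in> B"] \<omega>_set[of S "\<lambda>_. True"] by simp
  qed
  have cond_zero: "(AE x in M. cond_exp_on M \<omega> (D t) x = 0) \<longleftrightarrow>
      (\<forall>S\<in>sets borel. (LINT x:{x \<in> space M. \<omega> x \<in> S}|M. D t x) = 0)" if "t \<in> {2..T}" for t
    by (rule cond_exp_on_eq_0_iff[OF \<omega> D[OF that]])
  have trends: "parallel_trends M T (Y \<infinity>) G \<longleftrightarrow> (\<forall>t\<in>{2..T}. \<forall>g\<in>adoption_labels T.
      (LINT x:{x \<in> space M. G x = g}|M. D t x) = 0)"
    if "G \<in> measurable M (count_space (adoption_labels T))" "all_groups_nondegenerate M T G" for G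
    unfolding D_def by (rule parallel_trends_iff[OF that assms(11)])
  show ?thesis (is "?PT \<longleftrightarrow> ?CE")
    unfolding D_def[symmetric]
  proof
    assume zero: "\<forall>t\<in>{2..T}. AE x in M. cond_exp_on M \<omega> (D t) x = 0"
    show ?PT
    proof (intro ballI impI)
      fix h G
      assume h: "h \<in> selection_mechanisms T (rv_support M \<omega>) (rv_support M \<nu>)"
        and G: "G \<in> measurable M (count_space (adoption_labels T))"
        and Gh: "AE x in M. G x = h (\<omega> x, \<nu> x)"
        and nondeg: "all_groups_nondegenerate M T G"
      show "parallel_trends M T (Y \<infinity>) G"
        unfolding trends[OF G nondeg]
      proof (intro ballI)
        fix t g assume t: "t \<in> {2..T}" and g: "g \<in> adoption_labels T"
        show "(LINT x:{x \<in> space M. G x = g}|M. D t x) = 0"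
        \<comment> \<open>Only rectangles remain to be checked; there independence splits off the
          \<nu> factor and (2) annihilates the other one.\<close>
        proof (rule AE_group_eq_imp_integral_zero[OF \<omega> \<nu> D[OF t] _ h G Gh g])
          fix S :: "'o set" and B :: "real set" assume S: "S \<in> sets borel" and B: "B \<in> sets borel"
          have "(LINT x:{x \<in> space M. \<omega> x \<in> S}|M. D t x) = 0"
            using zero t cond_zero[OF t] S by blast
          then show "(LINT x:{x \<in> space M. \<omega> x \<in> S \<and> \<nu> x \<in> B}|M. D t x) = 0"
            by (simp add: factor[OF t S B])
        qed
      qed
    qed
  next
    assume PT: ?PT
    obtain B where B: "\<And>g. g \<in> adoption_labels T \<Longrightarrow> B g \<in> sets borel"
      and disj: "disjoint_family_on B (adoption_labels T)"
      and pos: "\<And>g. g \<in> adoption_labels T \<Longrightarrow> prob {x \<in> space M. \<nu> x \<in> B g} > 0"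
    proof -
      from assms(16) obtain B where
        "(\<forall>g\<in>adoption_labels T. B g \<in> sets borel) \<and>
         disjoint_family_on B (adoption_labels T) \<and>
         (\<Union>g\<in>adoption_labels T. B g) = rv_support M \<nu> \<and>
         (\<forall>g\<in>adoption_labels T. 0 < prob {x \<in> space M. \<nu> x \<in> B g} \<and>
            prob {x \<in> space M. \<nu> x \<in> B g} < 1)" ..
      then show ?thesis by (intro that[of B]) simp_all
    qed
    have two: "enat 2 \<in> adoption_labels T"
      using assms(2) by (auto simp: adoption_labels_def)
    have "(LINT x:{x \<in> space M. \<omega> x \<in> S}|M. D t x) = 0"
      if t: "t \<in> {2..T}" and S [measurable]: "S \<in> sets borel" for t S
    proof (cases "prob {x \<in> space M. \<omega> x \<in> S} = 0")
      \<comment> \<open>Here the mechanism used in the other case would leave group 2 with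
        probability 0 and be inadmissible, but an integral over a null event is 0 anyway.\<close>
      case True
      then have "AE x in M. \<omega> x \<notin> S"
        by (subst AE_iff_measurable[OF _ refl]) (auto simp: emeasure_eq_measure)
      then show ?thesis
        unfolding set_lebesgue_integral_def by (intro integral_eq_zero_AE) auto
    next
      case False
      then have pos2: "prob {x \<in> space M. \<omega> x \<in> S \<and> \<nu> x \<in> B (enat 2)} > 0"
        using pos[OF two] by (simp add: prob_factor[OF S B[OF two]] zero_less_measure_iff)
      obtain h where h: "h \<in> selection_mechanisms T (rv_support M \<omega>) (rv_support M \<nu>)"
        and G: "(\<lambda>x. h (\<omega> x, \<nu> x)) \<in> measurable M (count_space (adoption_labels T))"
        and nondeg: "all_groups_nondegenerate M T (\<lambda>x. h (\<omega> x, \<nu> x))"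
        and h2: "\<And>x. h (\<omega> x, \<nu> x) = enat 2 \<longleftrightarrow> \<omega> x \<in> S \<and> \<nu> x \<in> B (enat 2)"
        by (rule exists_selection_mechanism[OF assms(2) \<omega> \<nu> S B disj pos pos2])
          (assumption | rule that)+
      \<comment> \<open>The group variable is \<open>h\<close> of the two arguments itself, so the
        almost sure equality is trivial.\<close>
      have "parallel_trends M T (Y \<infinity>) (\<lambda>x. h (\<omega> x, \<nu> x))"
        by (rule PT[rule_format, OF h G _ nondeg]) simp
      then have "(LINT x:{x \<in> space M. \<omega> x \<in> S \<and> \<nu> x \<in> B (enat 2)}|M. D t x) = 0"
        unfolding trends[OF G nondeg] h2[symmetric] using t two by blast
      \<comment> \<open>The integral over group 2 factors by independence, and the probability of
        \<open>B (enat 2)\<close> is positive and cancels.\<close>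
      then show ?thesis
        using factor[OF t S B[OF two]] pos[OF two] by simp
    qed
    then show "\<forall>t\<in>{2..T}. AE x in M. cond_exp_on M \<omega> (D t) x = 0"
      using cond_zero by blast
  qed
qed

end
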